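(* There exists a universal constant $c>0$ such that for every $n\in\mathbb{N}$, $$ c\sqrt{n}\leq C_n\leq n,$$ where $$C_n=\sup\left\{\frac{\gamma_+(A)}{\|A\|_1}:A\in\mathbb{C}^{n\times n},\ A\succeq 0,\ A\neq 0\right\}.$$
   Context: For a self-adjoint positive semidefinite matrix $A\in\mathbb{C}^{n\times n}$, define $$\gamma_+(A):=\inf\left\{\sum_{k=1}^p\|x_k\|_1^2:\ p\in\mathbb{N},\ x_1,\ldots,x_p\in\mathbb{C}^n,\ \sum_{k=1}^p x_kx_k^*=A\right\},$$ where for a vector $x\in\mathbb{C}^n$, $\|x\|_1=\sum_i|x_i|$. For a matrix $A$, $\|A\|_1=\sum_{i,j}|A_{ij}|$ denotes the entrywise $1$-norm. $A\succeq 0$ means $A$ is self-adjoint positive semidefinite. *)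

theory Defs
  imports "HOL-Analysis.Analysis"
begin

text \<open>n x n complex matrices are represented as functions nat => nat => complex,
  only the entries with indices < n being relevant; vectors in C^n as nat => complex.\<close>

definition vec_l1 :: "nat \<Rightarrow> (nat \<Rightarrow> complex) \<Rightarrow> real" where
  "vec_l1 n x = (\<Sum>i<n. cmod (x i))"

definition mat_l1 :: "nat \<Rightarrow> (nat \<Rightarrow> nat \<Rightarrow> complex) \<Rightarrow> real" where
  "mat_l1 n A = (\<Sum>i<n. \<Sum>j<n. cmod (A i j))"

definition psd :: "nat \<Rightarrow> (nat \<Rightarrow> nat \<Rightarrow> complex) \<Rightarrow> bool" where
  "psd n A \<longleftrightarrow> (\<forall>i<n. \<forall>j<n. A i j = cnj (A j i)) \<and>
     (\<forall>x::nat \<Rightarrow> complex. let q = (\<Sum>i<n. \<Sum>j<n. cnj (x i) * A i j * x j)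
                              in Im q = 0 \<and> Re q \<ge> 0)"

definition nonzero_mat :: "nat \<Rightarrow> (nat \<Rightarrow> nat \<Rightarrow> complex) \<Rightarrow> bool" where
  "nonzero_mat n A \<longleftrightarrow> (\<exists>i<n. \<exists>j<n. A i j \<noteq> 0)"

definition gamma_plus :: "nat \<Rightarrow> (nat \<Rightarrow> nat \<Rightarrow> complex) \<Rightarrow> real" where
  "gamma_plus n A = Inf {(\<Sum>k<p. (vec_l1 n (xs k))\<^sup>2) | (p::nat) (xs::nat \<Rightarrow> nat \<Rightarrow> complex).
      (\<forall>i<n. \<forall>j<n. (\<Sum>k<p. xs k i * cnj (xs k j)) = A i j)}"

definition C_const :: "nat \<Rightarrow> real" where
  "C_const n = Sup {gamma_plus n A / mat_l1 n A | A. psd n A \<and> nonzero_mat n A}"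

end

theory Submission
  imports Defs
begin

text \<open>
  Upper bound: every decomposition satisfies \<open>\<Sum> \<parallel>x\<^sub>k\<parallel>\<^sub>1\<^sup>2 \<le> n \<Sum> \<parallel>x\<^sub>k\<parallel>\<^sub>2\<^sup>2 = n tr A \<le> n \<parallel>A\<parallel>\<^sub>1\<close>, and a
  decomposition exists by Cholesky elimination.

  Lower bound: take \<open>A = B B\<^sup>T\<close> for an \<open>n \<times> d\<close> random sign matrix \<open>B\<close> with \<open>d\<close> a small constant fraction
  of \<open>n\<close>. With positive probability \<open>\<parallel>B s\<parallel>\<^sub>1 \<le> 4 n \<surd>d\<close> for all sign vectors \<open>s\<close> and
  \<open>\<parallel>B y\<parallel>\<^sub>1 \<ge> c n \<parallel>y\<parallel>\<^sub>2\<close> for all \<open>y\<close> (Kashin's theorem: the range of \<open>B\<close> consists of spread-out vectors).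
  The rows of \<open>B\<close> are sign vectors, so the first property gives \<open>\<parallel>A\<parallel>\<^sub>1 \<le> 4 n\<^sup>2 \<surd>d\<close>. In a decomposition
  of \<open>A\<close> every \<open>x\<^sub>k\<close> is \<open>B y\<^sub>k\<close> with \<open>\<Sum> y\<^sub>k y\<^sub>k\<^sup>* = I\<close>, so the second property gives
  \<open>\<Sum> \<parallel>x\<^sub>k\<parallel>\<^sub>1\<^sup>2 \<ge> c' n\<^sup>2 d\<close>. The quotient is of order \<open>\<surd>d\<close>. For the second property, a union bound over
  integer points of \<open>\<ell>\<^sub>1\<close>-norm \<open>O(d)\<close> suffices: an arbitrary \<open>y\<close> is rounded to such a point, and the
  error is controlled by the first property.
\<close>

section \<open>Positive semidefinite matrices and their decompositions\<close>

definition qform :: "nat \<Rightarrow> (nat \<Rightarrow> nat \<Rightarrow> complex) \<Rightarrow> (nat \<Rightarrow> complex) \<Rightarrow> complex" where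
  "qform n A x = (\<Sum>i<n. \<Sum>j<n. cnj (x i) * A i j * x j)"

definition is_decomp :: "nat \<Rightarrow> (nat \<Rightarrow> nat \<Rightarrow> complex) \<Rightarrow> nat \<Rightarrow> (nat \<Rightarrow> nat \<Rightarrow> complex) \<Rightarrow> bool" where
  "is_decomp n A p xs \<longleftrightarrow> (\<forall>i<n. \<forall>j<n. (\<Sum>k<p. xs k i * cnj (xs k j)) = A i j)"

lemma psd_iff_qform:
  "psd n A \<longleftrightarrow> (\<forall>i<n. \<forall>j<n. A i j = cnj (A j i)) \<and> (\<forall>x. Im (qform n A x) = 0 \<and> Re (qform n A x) \<ge> 0)"
  by (simp add: psd_def qform_def Let_def)

lemma psd_diag:
  assumes "psd n A" "i < n"
  shows "A i i = complex_of_real (Re (A i i))"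
  using assms unfolding psd_iff_qform by (metis Reals_cnj_iff of_real_Re)

section \<open>Quadratic forms and Cholesky elimination\<close>

text \<open>Here \<open>s v\<close> is entry \<open>m\<close> of the row vector
  \<open>v^* A\<close>. The explicit dependence on \<open>t\<close> serves two choices of
  \<open>t\<close>: one drives the form below zero when the diagonal entry vanishes, the other
  completes the square.\<close>

lemma qform_shift:
  assumes herm: "\<forall>i<n. \<forall>j<n. A i j = cnj (A j i)" and m: "m < n"
  defines "s \<equiv> \<lambda>v. \<Sum>i<n. cnj (v i) * A i m"
  shows "qform n A (\<lambda>i. v i + (if i = m then t else 0)) =
     qform n A v + t * s v + cnj (t * s v) + cnj t * t * A m m"
proof -
  have 1: "(\<Sum>j<n. A m j * v j) = cnj (s v)"
  proof -
    have "A m j = cnj (A j m)" if "j < n" for j using herm m that by blast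
    then show ?thesis unfolding s_def cnj_sum by (intro sum.cong refl) (simp add: mult.commute)
  qed
  have "qform n A (\<lambda>i. v i + (if i = m then t else 0)) =
     (\<Sum>i<n. (\<Sum>j<n. cnj (v i) * A i j * v j) + cnj (v i) * A i m * t
        + (if i = m then (\<Sum>j<n. cnj t * A i j * v j) + cnj t * A i m * t else 0))"
    unfolding qform_def
  proof (intro sum.cong refl)
    fix i assume "i \<in> {..<n}"
    have "(\<Sum>j<n. cnj (v i + (if i = m then t else 0)) * A i j * (v j + (if j = m then t else 0)))
      = (\<Sum>j<n. cnj (v i + (if i = m then t else 0)) * A i j * v j
          + (if j = m then cnj (v i + (if i = m then t else 0)) * A i m * t else 0))"
      by (intro sum.cong refl) (auto simp: algebra_simps)
    also have "\<dots> = (\<Sum>j<n. cnj (v i + (if i = m then t else 0)) * A i j * v j)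
          + cnj (v i + (if i = m then t else 0)) * A i m * t"
      using m by (simp add: sum.distrib)
    also have "\<dots> = (\<Sum>j<n. cnj (v i) * A i j * v j) + cnj (v i) * A i m * t
        + (if i = m then (\<Sum>j<n. cnj t * A i j * v j) + cnj t * A i m * t else 0)"
      by (auto simp: algebra_simps sum.distrib)
    finally show "(\<Sum>j<n. cnj (v i + (if i = m then t else 0)) * A i j * (v j + (if j = m then t else 0)))
      = (\<Sum>j<n. cnj (v i) * A i j * v j) + cnj (v i) * A i m * t
        + (if i = m then (\<Sum>j<n. cnj t * A i j * v j) + cnj t * A i m * t else 0)" .
  qed
  also have "\<dots> = qform n A v + s v * t + cnj t * (\<Sum>j<n. A m j * v j) + cnj t * A m m * t"
    using m by (simp add: sum.distrib qform_def s_def sum_distrib_right sum_distrib_left mult.assoc)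
  finally show ?thesis unfolding 1 by (simp add: algebra_simps)
qed

text \<open>With a zero diagonal entry the form is real-affine in coordinate \<open>m\<close>, so a
  nonzero slope \<open>A i m\<close> would make it negative somewhere.\<close>

lemma psd_zero_diag:
  assumes psd: "psd n A" and m: "m < n" and i: "i < n" and 0: "A m m = 0"
  shows "A i m = 0"
proof (rule ccontr)
  assume nz: "A i m \<noteq> 0"
  define e where "e = (\<lambda>k. if k = i then 1 else 0 :: complex)"
  have herm: "\<forall>i<n. \<forall>j<n. A i j = cnj (A j i)"
    using psd unfolding psd_iff_qform by blast
  have s: "(\<Sum>k<n. cnj (e k) * A k m) = A i m"
  proof -
    have "(\<Sum>k<n. cnj (e k) * A k m) = (\<Sum>k<n. if k = i then A i m else 0)"
      by (intro sum.cong) (auto simp: e_def)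
    then show ?thesis using i by simp
  qed
  \<comment> \<open>Chosen so that the decrease \<open>2 * r * (cmod (A i m))\<^sup>2\<close>
    exceeds the value at \<open>e\<close> by exactly 1.\<close>
  define r where "r = (Re (qform n A e) + 1) / (2 * (cmod (A i m))\<^sup>2)"
  define t where "t = - (complex_of_real r * cnj (A i m))"
  have ts: "t * A i m = complex_of_real (- r * (cmod (A i m))\<^sup>2)"
    unfolding t_def using complex_norm_square[of "A i m"] by (simp add: mult.assoc mult.commute)
  have "Re (qform n A (\<lambda>k. e k + (if k = m then t else 0))) = Re (qform n A e) - 2 * r * (cmod (A i m))\<^sup>2"
    unfolding qform_shift[OF herm m] s ts 0 by simp
  also have "\<dots> = -1" unfolding r_def using nz by (simp add: field_simps)
  finally show False using psd unfolding psd_iff_qform by (smt (verit))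
qed

text \<open>One Cholesky step. For a positive pivot, \<open>x\<close> is column \<open>m\<close>
  divided by the root of the pivot and the remainder is the Schur complement; for a zero pivot, row
  \<open>m\<close> already vanishes and \<open>x = 0\<close> works.\<close>

lemma psd_eliminate:
  assumes psd: "psd n A" and m: "m < n" and zero: "\<And>i j. i < m \<Longrightarrow> j < n \<Longrightarrow> A i j = 0"
  obtains x where "psd n (\<lambda>i j. A i j - x i * cnj (x j))"
    and "\<And>i j. i < Suc m \<Longrightarrow> j < n \<Longrightarrow> A i j - x i * cnj (x j) = 0"
proof (cases "A m m = 0")
  case True
  have "A i j = 0" if "i < Suc m" "j < n" for i j
  proof (cases "i < m")
    case False
    then have "i = m" using that by simp
    moreover have "A m j = cnj (A j m)" using psd m that unfolding psd_def by blast
    ultimately show ?thesis using psd_zero_diag[OF psd m \<open>j < n\<close> True] by simp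
  qed (use zero that in auto)
  then show ?thesis using that[of "\<lambda>_. 0"] psd by simp
next
  case False
  define a where "a = Re (A m m)"
  have Amm: "A m m = of_real a" unfolding a_def by (rule psd_diag[OF psd m])
  have herm: "\<forall>i<n. \<forall>j<n. A i j = cnj (A j i)"
    using psd unfolding psd_iff_qform by blast
  have pos: "Re (qform n A v) \<ge> 0" "Im (qform n A v) = 0" for v
    using psd unfolding psd_iff_qform by auto
  have "qform n A (\<lambda>k. 0 + (if k = m then 1 else 0)) = of_real a"
    by (subst qform_shift[OF herm m]) (simp add: qform_def Amm)
  with pos[of "\<lambda>k. 0 + (if k = m then 1 else 0)"] have "a \<ge> 0" by simp
  with False Amm have a: "a > 0" by (cases "a = 0") auto
  define x where "x = (\<lambda>i. A i m / of_real (sqrt a))"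
  have sq: "complex_of_real (sqrt a) * complex_of_real (sqrt a) = of_real a"
    using a by (metis of_real_mult real_sqrt_mult_self abs_of_pos)
  have xx: "x i * cnj (x j) = A i m * cnj (A j m) / of_real a" for i j
    unfolding x_def using sq by simp
  have "A i j - x i * cnj (x j) = 0" if "i < Suc m" "j < n" for i j
  proof (cases "i < m")
    case False
    then have "i = m" using that by simp
    moreover have "A m j = cnj (A j m)" using herm m that by blast
    ultimately show ?thesis using a by (simp add: xx Amm)
  qed (use zero[of i] that m in \<open>auto simp: xx\<close>)
  moreover have "psd n (\<lambda>i j. A i j - x i * cnj (x j))"
    unfolding psd_iff_qform
  proof (intro conjI allI impI)
    fix i j assume "i < n" "j < n"
    then have "A i j = cnj (A j i)" using herm by blast
    then show "A i j - x i * cnj (x j) = cnj (A j i - x j * cnj (x i))" by simp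
  next
    fix v
    define s where "s = (\<Sum>i<n. cnj (v i) * A i m)"
    \<comment> \<open>The minimizer in coordinate \<open>m\<close>: the form of the remainder at
      \<open>v\<close> equals the form of \<open>A\<close> at \<open>v\<close> shifted by
      \<open>t\<close> there, hence is nonnegative.\<close>
    define t where "t = - (cnj s / of_real a)"
    have s': "(\<Sum>j<n. cnj (A j m) * v j) = cnj s"
      unfolding s_def by (simp add: mult.commute)
    have "qform n (\<lambda>i j. A i j - x i * cnj (x j)) v
       = qform n A v - (\<Sum>i<n. \<Sum>j<n. (cnj (v i) * A i m) * (cnj (A j m) * v j) / of_real a)"
      unfolding qform_def xx sum_subtractf[symmetric]
      by (intro sum.cong refl) (simp add: algebra_simps)
    also have "\<dots> = qform n A v - s * cnj s / of_real a"
      by (simp only: sum_divide_distrib[symmetric] sum_product[symmetric] s' s_def[symmetric])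
    also have "\<dots> = qform n A (\<lambda>k. v k + (if k = m then t else 0))"
      unfolding qform_shift[OF herm m] s_def[symmetric] t_def Amm using a by (simp add: field_simps)
    finally have "qform n (\<lambda>i j. A i j - x i * cnj (x j)) v = qform n A (\<lambda>k. v k + (if k = m then t else 0))" .
    then show "Im (qform n (\<lambda>i j. A i j - x i * cnj (x j)) v) = 0"
      "0 \<le> Re (qform n (\<lambda>i j. A i j - x i * cnj (x j)) v)" using pos by simp_all
  qed
  ultimately show ?thesis using that by blast
qed

text \<open>After \<open>m\<close> elimination steps the first \<open>m\<close> rows of the
  remainder vanish, so \<open>n\<close> vectors exhaust \<open>A\<close>.\<close>

lemma psd_decomp:
  assumes "psd n A"
  obtains xs where "is_decomp n A n xs"
proof -
  have "\<exists>xs. psd n (\<lambda>i j. A i j - (\<Sum>k<m. xs k i * cnj (xs k j))) \<and>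
      (\<forall>i<m. \<forall>j<n. A i j - (\<Sum>k<m. xs k i * cnj (xs k j)) = 0)" if "m \<le> n" for m
    using that
  proof (induction m)
    case 0
    then show ?case using assms by simp
  next
    case (Suc m)
    then obtain xs where xs: "psd n (\<lambda>i j. A i j - (\<Sum>k<m. xs k i * cnj (xs k j)))"
      "\<And>i j. i < m \<Longrightarrow> j < n \<Longrightarrow> A i j - (\<Sum>k<m. xs k i * cnj (xs k j)) = 0" by auto
    have "m < n" using Suc.prems by simp
    obtain x where x: "psd n (\<lambda>i j. A i j - (\<Sum>k<m. xs k i * cnj (xs k j)) - x i * cnj (x j))"
      "\<And>i j. i < Suc m \<Longrightarrow> j < n \<Longrightarrow> A i j - (\<Sum>k<m. xs k i * cnj (xs k j)) - x i * cnj (x j) = 0"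
      by (rule psd_eliminate[OF xs(1) \<open>m < n\<close>]) (use xs(2) in blast)+
    have "(\<Sum>k<Suc m. (xs(m := x)) k i * cnj ((xs(m := x)) k j))
        = (\<Sum>k<m. xs k i * cnj (xs k j)) + x i * cnj (x j)" for i j by simp
    then show ?case using x by (intro exI[of _ "xs(m := x)"]) (simp add: diff_diff_eq)
  qed
  from this[of n, OF order_refl] obtain xs where
    "\<forall>i<n. \<forall>j<n. A i j - (\<Sum>k<n. xs k i * cnj (xs k j)) = 0" by auto
  then have "is_decomp n A n xs" unfolding is_decomp_def by auto
  then show ?thesis by (rule that)
qed

text \<open>The right side involves only \<open>A\<close>, so two decompositions of the same matrix
  can be compared through linear functionals.\<close>

lemma decomp_form:
  assumes "is_decomp n A p xs"
  shows "complex_of_real (\<Sum>k<p. (cmod (\<Sum>i<n. l i * xs k i))\<^sup>2) = (\<Sum>i<n. \<Sum>j<n. l i * A i j * cnj (l j))"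
proof -
  have "complex_of_real (\<Sum>k<p. (cmod (\<Sum>i<n. l i * xs k i))\<^sup>2)
    = (\<Sum>k<p. \<Sum>i<n. \<Sum>j<n. l i * (xs k i * cnj (xs k j)) * cnj (l j))"
    unfolding of_real_sum complex_norm_square
    by (simp add: sum_product algebra_simps)
  also have "\<dots> = (\<Sum>i<n. \<Sum>j<n. \<Sum>k<p. l i * (xs k i * cnj (xs k j)) * cnj (l j))"
    by (subst sum.swap) (intro sum.cong refl sum.swap)
  also have "\<dots> = (\<Sum>i<n. \<Sum>j<n. l i * A i j * cnj (l j))"
    using assms unfolding is_decomp_def
    by (intro sum.cong refl) (simp add: sum_distrib_left[symmetric] sum_distrib_right[symmetric])
  finally show ?thesis .
qed

lemma decomp_diag:
  assumes "is_decomp n A p xs" "i < n"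
  shows "A i i = of_real (\<Sum>k<p. (cmod (xs k i))\<^sup>2)"
proof -
  have "A i i = (\<Sum>k<p. xs k i * cnj (xs k i))" using assms unfolding is_decomp_def by auto
  then show ?thesis unfolding of_real_sum complex_norm_square .
qed

lemma psd_if_decomp:
  assumes d: "is_decomp n A p xs"
  shows "psd n A"
  unfolding psd_iff_qform
proof (intro conjI allI impI)
  fix i j assume "i < n" "j < n"
  then have "A i j = (\<Sum>k<p. xs k i * cnj (xs k j))" "A j i = (\<Sum>k<p. xs k j * cnj (xs k i))"
    using d unfolding is_decomp_def by auto
  then show "A i j = cnj (A j i)" by (simp add: mult.commute)
next
  fix x
  have "qform n A x = of_real (\<Sum>k<p. (cmod (\<Sum>i<n. cnj (x i) * xs k i))\<^sup>2)"
    unfolding decomp_form[OF d] qform_def by simp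
  then show "Im (qform n A x) = 0" "Re (qform n A x) \<ge> 0" by (simp_all add: sum_nonneg)
qed

section \<open>The infimum \<open>gamma_plus\<close>, the upper bound and the trivial lower
  bound\<close>

lemma gamma_plus_alt: "gamma_plus n A = Inf {(\<Sum>k<p. (vec_l1 n (xs k))\<^sup>2) | p xs. is_decomp n A p xs}"
  unfolding gamma_plus_def is_decomp_def ..

lemma gamma_plus_le:
  assumes "is_decomp n A p xs"
  shows "gamma_plus n A \<le> (\<Sum>k<p. (vec_l1 n (xs k))\<^sup>2)"
  unfolding gamma_plus_alt
  by (rule cInf_lower, use assms in blast, rule bdd_belowI[of _ 0]) (auto intro: sum_nonneg)

text \<open>Semidefiniteness supplies a decomposition, so the infimum is over a nonempty set;
  \<open>Inf\<close> of an empty set of reals would carry no information.\<close>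

lemma gamma_plus_ge:
  assumes "psd n A" "\<And>p xs. is_decomp n A p xs \<Longrightarrow> c \<le> (\<Sum>k<p. (vec_l1 n (xs k))\<^sup>2)"
  shows "c \<le> gamma_plus n A"
  unfolding gamma_plus_alt
proof (rule cInf_greatest)
  obtain xs where "is_decomp n A n xs" using psd_decomp[OF assms(1)] .
  then show "{(\<Sum>k<p. (vec_l1 n (xs k))\<^sup>2) | p xs. is_decomp n A p xs} \<noteq> {}" by blast
qed (use assms(2) in auto)

lemma mat_l1_pos:
  assumes "nonzero_mat n A"
  shows "mat_l1 n A > 0"
proof -
  obtain i j where ij: "i < n" "j < n" "A i j \<noteq> 0" using assms unfolding nonzero_mat_def by auto
  have "0 < cmod (A i j)" using ij by simp
  also have "\<dots> \<le> (\<Sum>j<n. cmod (A i j))" using ij by (intro member_le_sum) auto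
  also have "\<dots> \<le> mat_l1 n A" unfolding mat_l1_def
    using ij by (intro member_le_sum[of i _ "\<lambda>i. \<Sum>j<n. cmod (A i j)"]) (auto intro: sum_nonneg)
  finally show ?thesis .
qed

lemma gamma_plus_le_mat_l1:
  assumes "psd n A"
  shows "gamma_plus n A \<le> real n * mat_l1 n A"
proof -
  obtain xs where xs: "is_decomp n A n xs" using psd_decomp[OF assms] .
  have "gamma_plus n A \<le> (\<Sum>k<n. (vec_l1 n (xs k))\<^sup>2)" by (rule gamma_plus_le[OF xs])
  also have "\<dots> \<le> (\<Sum>k<n. real n * (\<Sum>i<n. (cmod (xs k i))\<^sup>2))"
  proof (rule sum_mono)
    fix k
    show "(vec_l1 n (xs k))\<^sup>2 \<le> real n * (\<Sum>i<n. (cmod (xs k i))\<^sup>2)"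
      using sum_squared_le_sum_of_squares[of "\<lambda>i. cmod (xs k i)" "{..<n}"] unfolding vec_l1_def
      by (simp add: mult.commute)
  qed
  also have "\<dots> = real n * (\<Sum>i<n. \<Sum>k<n. (cmod (xs k i))\<^sup>2)"
    unfolding sum_distrib_left[symmetric] by (subst sum.swap) simp
  also have "\<dots> = real n * (\<Sum>i<n. cmod (A i i))"
    proof -
    have "cmod (A i i) = (\<Sum>k<n. (cmod (xs k i))\<^sup>2)" if "i < n" for i
      unfolding decomp_diag[OF xs that] norm_of_real by (simp add: sum_nonneg)
    then show ?thesis by simp
  qed
  also have "\<dots> \<le> real n * mat_l1 n A" unfolding mat_l1_def
    by (intro mult_left_mono sum_mono member_le_sum) auto
  finally show ?thesis .
qed

text \<open>The entrywise norm of \<open>x x^*\<close> is the squared l1-norm of \<open>x\<close>;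
  the triangle inequality does the rest.\<close>

lemma mat_l1_le_decomp:
  assumes "is_decomp n A p xs"
  shows "mat_l1 n A \<le> (\<Sum>k<p. (vec_l1 n (xs k))\<^sup>2)"
proof -
  have "mat_l1 n A = (\<Sum>i<n. \<Sum>j<n. cmod (\<Sum>k<p. xs k i * cnj (xs k j)))"
    using assms unfolding mat_l1_def is_decomp_def by (intro sum.cong) auto
  also have "\<dots> \<le> (\<Sum>i<n. \<Sum>j<n. \<Sum>k<p. cmod (xs k i) * cmod (xs k j))"
    by (intro sum_mono order_trans[OF norm_sum]) (simp add: norm_mult)
  also have "\<dots> = (\<Sum>k<p. \<Sum>i<n. \<Sum>j<n. cmod (xs k i) * cmod (xs k j))"
    by (subst (2) sum.swap, subst sum.swap) (rule refl)
  also have "\<dots> = (\<Sum>k<p. (vec_l1 n (xs k))\<^sup>2)"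
    unfolding vec_l1_def power2_eq_square sum_product ..
  finally show ?thesis .
qed

lemma ratio_le:
  assumes "psd n A" "nonzero_mat n A"
  shows "gamma_plus n A / mat_l1 n A \<le> real n"
  using gamma_plus_le_mat_l1[OF assms(1)] mat_l1_pos[OF assms(2)] by (simp add: divide_le_eq)

text \<open>The ratios are bounded by \<open>n\<close>, so \<open>Sup\<close> is a genuine upper
  bound of each of them.\<close>

lemma C_const_ge:
  assumes "psd n A" "nonzero_mat n A" "c * mat_l1 n A \<le> gamma_plus n A"
  shows "c \<le> C_const n"
proof -
  have "c \<le> gamma_plus n A / mat_l1 n A"
    using mat_l1_pos[OF assms(2)] assms(3) by (simp add: le_divide_eq)
  also have "\<dots> \<le> C_const n" unfolding C_const_def
    by (rule cSup_upper, use assms in blast, rule bdd_aboveI[of _ "real n"]) (auto intro: ratio_le)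
  finally show ?thesis .
qed

lemma psd_nonzero_exists:
  assumes "n \<ge> 1"
  obtains A where "psd n A" "nonzero_mat n A"
proof
  define A where "A = (\<lambda>(i::nat) (j::nat). if i = 0 \<and> j = 0 then 1 else 0 :: complex)"
  have "is_decomp n A 1 (\<lambda>_ i. if i = 0 then 1 else 0)" unfolding is_decomp_def A_def by auto
  then show "psd n A" by (rule psd_if_decomp)
  show "nonzero_mat n A" unfolding nonzero_mat_def A_def
    using assms by (intro exI[of _ 0]) auto
qed

lemma C_const_ge_1:
  assumes "n \<ge> 1"
  shows "1 \<le> C_const n"
proof -
  obtain A where A: "psd n A" "nonzero_mat n A" using psd_nonzero_exists[OF assms] .
  have "1 * mat_l1 n A \<le> gamma_plus n A"
    using A(1) by (intro gamma_plus_ge) (auto intro: mat_l1_le_decomp)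
  then show ?thesis by (rule C_const_ge[OF A])
qed

lemma C_const_le:
  assumes "n \<ge> 1"
  shows "C_const n \<le> real n"
  unfolding C_const_def
proof (rule cSup_least)
  obtain A where "psd n A" "nonzero_mat n A" using psd_nonzero_exists[OF assms] .
  then show "{gamma_plus n A / mat_l1 n A |A. psd n A \<and> nonzero_mat n A} \<noteq> {}" by blast
qed (auto intro: ratio_le)

section \<open>Random sign vectors\<close>

text \<open>Extensional functions form a finite set, so expectations over independent random signs
  become normalized finite sums.\<close>

definition signs :: "nat \<Rightarrow> (nat \<Rightarrow> real) set" where
  "signs d = {..<d} \<rightarrow>\<^sub>E {-1, 1}"

definition dot :: "nat \<Rightarrow> (nat \<Rightarrow> real) \<Rightarrow> (nat \<Rightarrow> real) \<Rightarrow> real" where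
  "dot d b y = (\<Sum>j<d. b j * y j)"

lemma finite_signs: "finite (signs d)"
  unfolding signs_def by (intro finite_PiE) auto

lemma card_signs: "card (signs d) = 2 ^ d"
  unfolding signs_def by (subst card_PiE) (auto simp: card_insert_if numeral_2_eq_2)

text \<open>Independence of the coordinates.\<close>

lemma sum_signs_prod:
  fixes g :: "nat \<Rightarrow> real \<Rightarrow> 'a :: comm_semiring_1"
  shows "(\<Sum>b\<in>signs d. \<Prod>j<d. g j (b j)) = (\<Prod>j<d. g j (-1) + g j 1)"
  unfolding signs_def by (subst prod_sum_PiE[symmetric]) auto

lemma sum_signs_exp: "(\<Sum>b\<in>signs d. exp (dot d b y)) = (\<Prod>j<d. exp (- y j) + exp (y j))"
  using sum_signs_prod[of "\<lambda>j s. exp (s * y j)" d] by (simp add: dot_def exp_sum)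

text \<open>Real part of the characteristic function of a signed sum; \<open>cis\<close> turns the
  sum into a product.\<close>

lemma sum_signs_cos: "(\<Sum>b\<in>signs d. cos (dot d b y)) = 2 ^ d * (\<Prod>j<d. cos (y j))"
proof -
  have "cis (\<Sum>j<d. f j) = (\<Prod>j<d. cis (f j))" for f :: "nat \<Rightarrow> real"
    by (induction d) (simp_all add: cis_mult[symmetric])
  then have "(\<Sum>b\<in>signs d. cis (dot d b y)) = (\<Prod>j<d. cis (- y j) + cis (y j))"
    using sum_signs_prod[of "\<lambda>j s. cis (s * y j)" d] by (simp add: dot_def)
  also have "\<dots> = (\<Prod>j<d. complex_of_real (2 * cos (y j)))"
    by (intro prod.cong refl) (simp add: complex_eq_iff)
  also have "\<dots> = complex_of_real (2 ^ d * (\<Prod>j<d. cos (y j)))"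
    by (simp add: prod.distrib)
  finally have "Re (\<Sum>b\<in>signs d. cis (dot d b y)) = 2 ^ d * (\<Prod>j<d. cos (y j))"
    by (metis Re_complex_of_real)
  then show ?thesis by simp
qed

section \<open>Exponential moments of signed sums\<close>

text \<open>By evenness take \<open>x \<ge> 0\<close>, and add
  \<open>exp x \<le> 1 + x + x\<^sup>2\<close> and
  \<open>exp (- x) \<le> 1 / (1 + x) \<le> 1 - x + x\<^sup>2\<close>.\<close>

lemma exp_add_exp_minus_le:
  fixes x :: real
  assumes "\<bar>x\<bar> \<le> 1"
  shows "exp (- x) + exp x \<le> 2 * exp (x\<^sup>2)"
proof -
  have *: "exp (- x) + exp x \<le> 2 * (1 + x\<^sup>2)" if "0 \<le> x" "x \<le> 1" for x :: real
  proof -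
    have "exp (- x) = 1 / exp x" by (simp add: exp_minus inverse_eq_divide)
    also have "\<dots> \<le> 1 / (1 + x)" using that by (intro divide_left_mono) (auto simp: add_pos_nonneg)
    also have "\<dots> \<le> 1 - x + x\<^sup>2"
    proof -
      have "(1 - x + x\<^sup>2) * (1 + x) = 1 + x ^ 3" by (simp add: algebra_simps power2_eq_square power3_eq_cube)
      then show ?thesis using that by (simp add: divide_le_eq)
    qed
    finally show ?thesis using exp_bound[OF that] by simp
  qed
  have "exp (- x) + exp x \<le> 2 * (1 + x\<^sup>2)"
    using *[of x] *[of "-x"] assms by (cases "x \<ge> 0") auto
  also have "\<dots> \<le> 2 * exp (x\<^sup>2)" by (intro mult_left_mono exp_ge_add_one_self) auto
  finally show ?thesis .
qed

text \<open>Subgaussian moment: each of the \<open>d\<close> factors is at most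
  \<open>2 * exp (1 / d)\<close>, giving \<open>exp 1 * 2 ^ d\<close>. The absolute value is split
  into both signs, and \<open>2 * exp 1 \<le> exp 2\<close>.\<close>

lemma sum_signs_exp_abs_le:
  assumes s: "s \<in> signs d" and d: "d \<ge> 1"
  shows "(\<Sum>b\<in>signs d. exp (\<bar>dot d b s\<bar> / sqrt d)) \<le> exp 2 * 2 ^ d"
proof -
  have s2: "\<bar>s j\<bar> = 1" if "j < d" for j
  proof -
    have "s j \<in> {-1, 1}" using s that unfolding signs_def by (auto simp: PiE_def Pi_def)
    then show ?thesis by auto
  qed
  have *: "(\<Sum>b\<in>signs d. exp (dot d b (\<lambda>j. c * s j / sqrt d))) \<le> exp 1 * 2 ^ d" if c: "\<bar>c\<bar> = 1" for c
  proof -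
    have "(\<Sum>b\<in>signs d. exp (dot d b (\<lambda>j. c * s j / sqrt d)))
       = (\<Prod>j<d. exp (- (c * s j / sqrt d)) + exp (c * s j / sqrt d))" by (rule sum_signs_exp)
    also have "\<dots> \<le> (\<Prod>j<d. 2 * exp (1 / d))"
    proof (intro prod_mono conjI)
      fix j assume "j \<in> {..<d}"
      then have a: "\<bar>c * s j\<bar> = 1" using s2 c by (simp add: abs_mult)
      then have b: "(c * s j)\<^sup>2 = 1" by (metis power2_abs one_power2)
      show "exp (- (c * s j / sqrt d)) + exp (c * s j / sqrt d) \<le> 2 * exp (1 / d)"
        using exp_add_exp_minus_le[of "c * s j / sqrt d"] a b d by (simp add: power_divide abs_divide)
    qed (auto intro: add_nonneg_nonneg)
    also have "\<dots> = 2 ^ d * exp (real d * (1 / d))" by (simp only: prod_constant power_mult_distrib card_lessThan exp_of_nat_mult)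
    finally show ?thesis using d by (simp add: mult.commute)
  qed
  have "(\<Sum>b\<in>signs d. exp (\<bar>dot d b s\<bar> / sqrt d))
    \<le> (\<Sum>b\<in>signs d. exp (dot d b (\<lambda>j. 1 * s j / sqrt d)) + exp (dot d b (\<lambda>j. - 1 * s j / sqrt d)))"
  proof (rule sum_mono)
    fix b
    have *: "dot d b (\<lambda>j. c * s j / sqrt d) = c * (dot d b s / sqrt d)" for c
      unfolding dot_def sum_distrib_left sum_divide_distrib by (intro sum.cong) auto
    show "exp (\<bar>dot d b s\<bar> / sqrt d) \<le> exp (dot d b (\<lambda>j. 1 * s j / sqrt d)) + exp (dot d b (\<lambda>j. - 1 * s j / sqrt d))"
      unfolding *[of 1] *[of "- 1"]
      by (cases "dot d b s \<ge> 0") (simp_all add: add_increasing add_increasing2)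
  qed
  also have "\<dots> \<le> exp 1 * 2 ^ d + exp 1 * 2 ^ d"
    unfolding sum.distrib by (intro add_mono *) auto
  also have "\<dots> \<le> exp 2 * 2 ^ d"
  proof -
    have "2 * exp 1 \<le> exp 1 * exp (1::real)" using exp_ge_add_one_self[of 1] by (intro mult_right_mono) auto
    then show ?thesis by (simp add: mult_exp_exp)
  qed
  finally show ?thesis .
qed

text \<open>Dominates the exponential by a function whose average over signs is explicit. For
  \<open>\<bar>t\<bar> \<le> 1\<close> the left side is at most \<open>1 - \<bar>t\<bar> / 2\<close>
  and the right side at least \<open>1 - t\<^sup>2 / 8\<close>; for larger
  \<open>\<bar>t\<bar>\<close> the value 1/2 separates them.\<close>

lemma exp_minus_abs_le:
  fixes t :: real
  shows "exp (- \<bar>t\<bar>) \<le> 1 - (1 - cos t) / 4"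
proof (cases "\<bar>t\<bar> \<le> 1")
  case True
  have "cos t \<ge> 1 - t\<^sup>2 / 2"
    using cos_double_sin[of "t/2"] abs_sin_le_one[of t] abs_sin_x_le_abs_x[of "t/2"]
      power_mono[of "\<bar>sin (t/2)\<bar>" "\<bar>t/2\<bar>" 2] by (simp add: power_divide)
  moreover have "t\<^sup>2 \<le> \<bar>t\<bar>"
    using True power_decreasing[of 1 2 "\<bar>t\<bar>"] by simp
  moreover have "exp (- \<bar>t\<bar>) \<le> 1 - \<bar>t\<bar> / 2"
  proof -
    have "exp (- \<bar>t\<bar>) = 1 / exp \<bar>t\<bar>" by (simp add: exp_minus inverse_eq_divide)
    also have "\<dots> \<le> 1 / (1 + \<bar>t\<bar>)" by (intro divide_left_mono) (auto simp: add_pos_nonneg)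
    also have "\<dots> \<le> 1 - \<bar>t\<bar> / 2"
    proof -
      have "1 \<le> 1 + (\<bar>t\<bar> - t\<^sup>2) / 2" using \<open>t\<^sup>2 \<le> \<bar>t\<bar>\<close> by simp
      also have "\<dots> = (1 - \<bar>t\<bar> / 2) * (1 + \<bar>t\<bar>)"
      proof -
        have "1 + (a - a\<^sup>2) / 2 = (1 - a / 2) * (1 + a)" for a :: real
          by (simp add: field_simps power2_eq_square)
        from this[of "\<bar>t\<bar>"] show ?thesis by simp
      qed
      finally show ?thesis by (subst pos_divide_le_eq) (auto simp: add_pos_nonneg)
    qed
    finally show ?thesis .
  qed
  ultimately show ?thesis by (simp add: field_simps)
next
  case False
  have "exp (- \<bar>t\<bar>) \<le> exp (- 1)" using False by simp
  also have "\<dots> \<le> (1/2::real)" using exp_ge_add_one_self[of "1::real"] by (simp add: exp_minus divide_simps)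
  also have "\<dots> \<le> 1 - (1 - cos t) / 4" using cos_ge_minus_one[of t] by argo
  finally show ?thesis .
qed

text \<open>Taylor expansion gives \<open>1 - y\<^sup>2 / 2 + y ^ 4 / 24\<close>, and
  \<open>y ^ 4 \<le> y\<^sup>2\<close>. Nonnegativity allows multiplying the bounds over
  coordinates.\<close>

lemma cos_le_exp:
  fixes y :: real
  assumes "\<bar>y\<bar> \<le> 1"
  shows "cos y \<ge> 0" "cos y \<le> exp (- (y\<^sup>2 / 4))"
proof -
  show "cos y \<ge> 0" using assms pi_gt3 by (intro cos_ge_zero) auto
  obtain t where t: "cos y = (\<Sum>m<4. cos_coeff m * y ^ m) + cos (t + 1/2 * real 4 * pi) / fact 4 * y ^ 4"
    using Maclaurin_cos_expansion[of y 4] by auto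
  have "cos (t + 1/2 * real 4 * pi) / fact 4 * y ^ 4 \<le> 1 / fact 4 * y ^ 4"
    by (intro mult_right_mono divide_right_mono) auto
  moreover have "(\<Sum>m<4. cos_coeff m * y ^ m) = 1 - y\<^sup>2 / 2"
    by (simp add: cos_coeff_def lessThan_nat_numeral lessThan_Suc fact_numeral)
  ultimately have "cos y \<le> 1 - y\<^sup>2 / 2 + y ^ 4 / 24" unfolding t by (simp add: fact_numeral)
  also have "y ^ 4 \<le> y\<^sup>2"
    using assms power_decreasing[of 2 4 "\<bar>y\<bar>"] by simp
  then have "1 - y\<^sup>2 / 2 + y ^ 4 / 24 \<le> 1 + (- (y\<^sup>2 / 4))" using zero_le_power2[of y] by linarith
  also have "\<dots> \<le> exp (- (y\<^sup>2 / 4))" by (rule exp_ge_add_one_self)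
  finally show "cos y \<le> exp (- (y\<^sup>2 / 4))" .
qed

text \<open>Anticoncentration: a signed sum with a unit coefficient vector is not too often near
  zero. The cosines multiply to at most \<open>exp (- 1 / 4) \<le> 4 / 5\<close>, and 3/4 + (4/5)/4
  = 19/20.\<close>

lemma sum_signs_exp_minus_abs_le:
  assumes y: "(\<Sum>j<d. (y j)\<^sup>2) = 1"
  shows "(\<Sum>b\<in>signs d. exp (- \<bar>dot d b y\<bar>)) \<le> 19 / 20 * 2 ^ d"
proof -
  have y1: "\<bar>y j\<bar> \<le> 1" if "j < d" for j
  proof -
    have "(y j)\<^sup>2 \<le> (\<Sum>j<d. (y j)\<^sup>2)" using that by (intro member_le_sum) auto
    then show ?thesis using y by (simp add: abs_square_le_1)
  qed
  have "(\<Prod>j<d. cos (y j)) \<le> (\<Prod>j<d. exp (- ((y j)\<^sup>2 / 4)))"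
    by (intro prod_mono conjI cos_le_exp y1) auto
  also have "\<dots> = exp (- 1 / 4)"
    by (simp add: exp_sum[symmetric] sum_negf sum_divide_distrib[symmetric] y)
  also have "\<dots> \<le> 4 / 5" using exp_ge_add_one_self[of "1/4::real"] by (simp add: exp_minus divide_simps)
  finally have p: "(\<Prod>j<d. cos (y j)) \<le> 4 / 5" .
  have "(\<Sum>b\<in>signs d. exp (- \<bar>dot d b y\<bar>)) \<le> (\<Sum>b\<in>signs d. 3 / 4 + cos (dot d b y) / 4)"
    by (intro sum_mono order_trans[OF exp_minus_abs_le]) (simp add: field_simps)
  also have "\<dots> = 2 ^ d * (3 / 4 + (\<Prod>j<d. cos (y j)) / 4)"
    by (simp add: sum.distrib sum_divide_distrib[symmetric] sum_signs_cos card_signs algebra_simps)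
  also have "\<dots> \<le> 2 ^ d * (19 / 20)" using p by (intro mult_left_mono) auto
  finally show ?thesis by simp
qed

text \<open>The method of conditional expectations: row by row, some choice does not increase the
  conditional expectation of the total weight.\<close>

lemma exists_rows:
  fixes f :: "'t \<Rightarrow> 'b \<Rightarrow> real" and r w :: "'t \<Rightarrow> real"
  assumes S: "finite S" "S \<noteq> {}" and T: "finite T"
    and f: "\<And>t b. t \<in> T \<Longrightarrow> b \<in> S \<Longrightarrow> f t b \<ge> 0"
    and avg: "\<And>t. t \<in> T \<Longrightarrow> (\<Sum>b\<in>S. f t b) \<le> r t * card S"
    and w: "\<And>t. t \<in> T \<Longrightarrow> w t \<ge> 0" and lt: "(\<Sum>t\<in>T. w t * r t ^ n) < 1"
  shows "\<exists>B. (\<forall>i<n. B i \<in> S) \<and> (\<forall>t\<in>T. w t * (\<Prod>i<n. f t (B i)) < 1)"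
  using w lt
proof (induction n arbitrary: w)
  case 0
  have "w t < 1" if "t \<in> T" for t
    using member_le_sum[of t T w] 0 that T by auto
  then show ?case by simp
next
  case (Suc n)
  have r: "r t \<ge> 0" if "t \<in> T" for t
  proof -
    have "0 \<le> r t * card S" using sum_nonneg[of S "f t", OF f[OF that]] avg[OF that] by linarith
    then show ?thesis using S by (simp add: zero_le_mult_iff card_gt_0_iff)
  qed
  have "(\<Sum>b\<in>S. \<Sum>t\<in>T. w t * f t b * r t ^ n) = (\<Sum>t\<in>T. (\<Sum>b\<in>S. f t b) * (w t * r t ^ n))"
    unfolding sum_distrib_right by (subst sum.swap) (simp only: mult_ac)
  also have "\<dots> \<le> (\<Sum>t\<in>T. (r t * card S) * (w t * r t ^ n))"
    using avg Suc.prems(1) r by (intro sum_mono mult_right_mono) auto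
  also have "\<dots> = card S * (\<Sum>t\<in>T. w t * r t ^ Suc n)"
    by (simp add: sum_distrib_left mult_ac)
  also have "\<dots> < real (card S) * 1"
    using Suc.prems(2) S by (intro mult_strict_left_mono) (auto simp: card_gt_0_iff)
  finally have "(\<Sum>b\<in>S. \<Sum>t\<in>T. w t * f t b * r t ^ n) < (\<Sum>b\<in>S. 1)" by simp
  then have "\<exists>b\<in>S. (\<Sum>t\<in>T. w t * f t b * r t ^ n) < 1"
    by (rule contrapos_pp) (simp only: not_less bex_simps ball_simps, intro sum_mono, blast)
  then obtain b where b: "b \<in> S" "(\<Sum>t\<in>T. w t * f t b * r t ^ n) < 1" by blast
  \<comment> \<open>The factor of the chosen row is absorbed into the weight, which is why the
    induction generalizes \<open>w\<close>.\<close>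
  obtain B where B: "\<forall>i<n. B i \<in> S" "\<forall>t\<in>T. (w t * f t b) * (\<Prod>i<n. f t (B i)) < 1"
    using Suc.IH[of "\<lambda>t. w t * f t b"] b f Suc.prems(1) by auto
  have "(\<Prod>i<Suc n. f t ((B(n := b)) i)) = f t b * (\<Prod>i<n. f t (B i))" for t
    by (simp add: mult.commute)
  then have "\<forall>t\<in>T. w t * (\<Prod>i<Suc n. f t ((B(n := b)) i)) < 1"
    using B(2) by (simp only: mult.assoc)
  moreover have "\<forall>i<Suc n. (B(n := b)) i \<in> S" using B(1) b(1) by (auto simp: less_Suc_eq)
  ultimately show ?case by blast
qed

section \<open>Counting integer points of bounded l1-norm\<close>

lemma sum_half_power_abs_le: "(\<Sum>k\<in>{- int N..int N}. (1 / 2) ^ nat \<bar>k\<bar>) \<le> (3 :: real)"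
proof -
  have "(\<Sum>k\<in>{- int N..int N}. (1 / 2) ^ nat \<bar>k\<bar>) = (3 :: real) - 2 * (1 / 2) ^ N"
  proof (induction N)
    case (Suc N)
    have "{- int (Suc N)..int (Suc N)} = insert (int (Suc N)) (insert (- int (Suc N)) {- int N..int N})" by auto
    then have "(\<Sum>k\<in>{- int (Suc N)..int (Suc N)}. (1 / 2) ^ nat \<bar>k\<bar>)
       = 2 * (1 / 2) ^ Suc N + (\<Sum>k\<in>{- int N..int N}. (1 / 2 :: real) ^ nat \<bar>k\<bar>)"
      by (subst \<open>{- int (Suc N)..int (Suc N)} = _\<close>) (simp add: nat_add_distrib)
    then show ?case unfolding Suc.IH by simp
  qed simp
  then show ?thesis by simp
qed

text \<open>For \<open>N\<close> proportional to \<open>d\<close> this ball has only exponentially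
  many points in \<open>d\<close>, while the surrounding box has \<open>(2 * N + 1) ^ d\<close>.
  Hence a union bound over it is affordable with \<open>n\<close> linear in
  \<open>d\<close>.\<close>

definition int_l1_ball :: "nat \<Rightarrow> nat \<Rightarrow> (nat \<Rightarrow> int) set" where
  "int_l1_ball d N = {z \<in> {..<d} \<rightarrow>\<^sub>E {- int N..int N}. (\<Sum>j<d. \<bar>z j\<bar>) \<le> int N}"

lemma finite_int_l1_ball: "finite (int_l1_ball d N)"
  unfolding int_l1_ball_def by (rule finite_subset[OF Collect_restrict]) (intro finite_PiE, auto)

lemma card_int_l1_ball: "real (card (int_l1_ball d N)) \<le> 2 ^ N * 3 ^ d"
proof -
  \<comment> \<open>Exponential weights: \<open>w \<ge> 1\<close> on the ball, and the sum of \<open>w\<close> over the box factorizes.\<close>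
  define w where "w z = (2 :: real) ^ N * (\<Prod>j<d. (1 / 2) ^ nat \<bar>z j\<bar>)" for z :: "nat \<Rightarrow> int"
  let ?box = "{..<d} \<rightarrow>\<^sub>E {- int N..int N}"
  have w_nonneg: "w z \<ge> 0" for z unfolding w_def by (intro mult_nonneg_nonneg prod_nonneg) auto
  have w_ge_1: "1 \<le> w z" if z: "z \<in> int_l1_ball d N" for z
  proof -
    have "int (\<Sum>j<d. nat \<bar>z j\<bar>) \<le> int N" using z unfolding int_l1_ball_def of_nat_sum by simp
    then have "(\<Sum>j<d. nat \<bar>z j\<bar>) \<le> N" by (simp only: of_nat_le_iff)
    then have "(1 / 2 :: real) ^ N \<le> (1 / 2) ^ (\<Sum>j<d. nat \<bar>z j\<bar>)"
      by (intro power_decreasing) auto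
    then have "2 ^ N * (1 / 2 :: real) ^ N \<le> 2 ^ N * (1 / 2) ^ (\<Sum>j<d. nat \<bar>z j\<bar>)" by simp
    then show ?thesis unfolding w_def by (simp add: power_sum power_one_over)
  qed
  have "real (card (int_l1_ball d N)) \<le> sum w (int_l1_ball d N)"
    using sum_bounded_below[of "int_l1_ball d N" 1 w] w_ge_1 by simp
  also have "sum w (int_l1_ball d N) \<le> sum w ?box"
    by (rule sum_mono2) (auto simp: int_l1_ball_def w_nonneg intro: finite_PiE)
  also have "sum w ?box = 2 ^ N * (\<Prod>j<d. \<Sum>k\<in>{- int N..int N}. (1 / 2) ^ nat \<bar>k\<bar>)"
    unfolding w_def by (subst prod_sum_PiE) (auto simp: sum_distrib_left)
  also have "\<dots> \<le> 2 ^ N * (\<Prod>j<d. 3)"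
    using sum_half_power_abs_le by (intro mult_left_mono prod_mono conjI sum_nonneg) auto
  finally show ?thesis by simp
qed

section \<open>A sign matrix with spread-out range\<close>

text \<open>Chernoff and union bound in one: an inequality failing at some \<open>s\<close> or
  \<open>z\<close> would make its weighted product at least 1, while the expected total weight is
  below 1.\<close>

lemma exists_sign_matrix:
  fixes d n :: nat
  assumes d: "d \<ge> 1" and n: "n \<ge> 13000 * d"
  obtains B where "\<And>i. i < n \<Longrightarrow> B i \<in> signs d"
    and "\<And>s. s \<in> signs d \<Longrightarrow> (\<Sum>i<n. \<bar>dot d (B i) s\<bar>) \<le> 4 * n * sqrt d"
    and "\<And>z. z \<in> int_l1_ball d (322 * d) \<Longrightarrow>
      n * L2_set (\<lambda>j. real_of_int (z j)) {..<d} \<le> 40 * (\<Sum>i<n. \<bar>dot d (B i) (\<lambda>j. real_of_int (z j))\<bar>)"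
proof -
  define len where "len z = L2_set (\<lambda>j. real_of_int (z j)) {..<d}" for z :: "nat \<Rightarrow> int"
  \<comment> \<open>The zero vector cannot be normalized; for it the claim is trivial.\<close>
  define Z where "Z = {z \<in> int_l1_ball d (322 * d). len z > 0}"
  \<comment> \<open>Left summand: exponential moments certifying the upper bound at a sign vector.
    Right summand: exponential moments certifying the lower bound at an integer point.\<close>
  define f :: "(nat \<Rightarrow> real) + (nat \<Rightarrow> int) \<Rightarrow> (nat \<Rightarrow> real) \<Rightarrow> real" where
    "f = case_sum (\<lambda>s b. exp (\<bar>dot d b s\<bar> / sqrt d))
           (\<lambda>z b. exp (- \<bar>dot d b (\<lambda>j. real_of_int (z j) / len z)\<bar>))"
  \<comment> \<open>The thresholds \<open>4 * n\<close> and \<open>n / 40\<close> in exponential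
    form; \<open>r\<close> holds the bounds on the average of \<open>f\<close> over one row.\<close>
  define w :: "(nat \<Rightarrow> real) + (nat \<Rightarrow> int) \<Rightarrow> real" where
    "w = case_sum (\<lambda>_. exp (- (4 * real n))) (\<lambda>_. exp (n / 40))"
  define r :: "(nat \<Rightarrow> real) + (nat \<Rightarrow> int) \<Rightarrow> real" where
    "r = case_sum (\<lambda>_. exp 2) (\<lambda>_. 19 / 20)"
  have Z: "finite Z" "card Z \<le> card (int_l1_ball d (322 * d))"
    unfolding Z_def using finite_int_l1_ball by (auto intro: card_mono)
  have e1: "exp (- 1) < (1 / 2 :: real)"
  proof -
    have "(3 / 2 :: real) * (3 / 2) \<le> exp (1 / 2) * exp (1 / 2)"
      using exp_ge_add_one_self[of "1 / 2 :: real"] by (intro mult_mono) auto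
    then have "exp 1 > (2 :: real)" by (simp add: mult_exp_exp)
    then show ?thesis by (simp add: exp_minus divide_simps)
  qed
  have two: "(2 :: real) ^ m \<le> exp m" for m
    using power_mono[of "2 :: real" "exp 1" m] exp_ge_add_one_self[of "1::real"]
    by (simp add: exp_of_nat_mult[symmetric])
  have "\<exists>B. (\<forall>i<n. B i \<in> signs d) \<and> (\<forall>t\<in>signs d <+> Z. w t * (\<Prod>i<n. f t (B i)) < 1)"
  proof (rule exists_rows[where r = r])
    show "finite (signs d)" "finite (signs d <+> Z)" using finite_signs Z by auto
    show "signs d \<noteq> {}" using card_signs[of d] by auto
    show "f t b \<ge> 0" "w t \<ge> 0" for t b
      unfolding f_def w_def by (auto split: sum.split)
  next
    fix t assume "t \<in> signs d <+> Z"
    then show "(\<Sum>b\<in>signs d. f t b) \<le> r t * card (signs d)"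
    proof (elim PlusE)
      fix s assume "s \<in> signs d" "t = Inl s"
      then show ?thesis using sum_signs_exp_abs_le[OF _ d] by (simp add: f_def r_def card_signs)
    next
      fix z assume z: "z \<in> Z" "t = Inr z"
      then have "len z > 0" unfolding Z_def by simp
      then have "(len z)\<^sup>2 > 0" by simp
      moreover have "(len z)\<^sup>2 = (\<Sum>j<d. (real_of_int (z j))\<^sup>2)"
        unfolding len_def L2_set_def by (simp add: sum_nonneg)
      ultimately have "(\<Sum>j<d. (real_of_int (z j) / len z)\<^sup>2) = 1"
        by (simp add: power_divide sum_divide_distrib[symmetric])
      from sum_signs_exp_minus_abs_le[OF this] show ?thesis
        using z by (simp add: f_def r_def card_signs)
    qed
  next
    have split: "(\<Sum>t\<in>signs d <+> Z. w t * r t ^ n)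
        = 2 ^ d * (exp (- (4 * real n)) * exp 2 ^ n) + card Z * (exp (n / 40) * (19 / 20) ^ n)"
      using finite_signs Z by (simp add: sum.Plus w_def r_def card_signs)
    have cube: "2 ^ d * (exp (- (4 * real n)) * exp 2 ^ n) \<le> exp (- 1 :: real)"
    proof -
      have "2 ^ d * (exp (- (4 * real n)) * exp 2 ^ n) \<le> exp d * (exp (- (4 * real n)) * exp 2 ^ n)"
        by (intro mult_right_mono two) auto
      also have "\<dots> = exp (real d - 2 * n)"
        by (simp add: exp_of_nat_mult[symmetric] mult_exp_exp)
      also have "\<dots> \<le> exp (- 1)" using d n by simp
      finally show ?thesis .
    qed
    have grid: "real (card Z) * (exp (n / 40) * (19 / 20) ^ n) \<le> exp (- 1 :: real)"
    proof -
      have "real (card Z) \<le> 2 ^ (322 * d) * 3 ^ d"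
        using Z(2) card_int_l1_ball[of d "322 * d"] by linarith
      also have "\<dots> \<le> 2 ^ (322 * d) * (2 ^ 2) ^ d" by (intro mult_left_mono power_mono) auto
      also have "\<dots> = 2 ^ (324 * d)" by (simp only: power_mult[symmetric] power_add[symmetric]) simp
      also have "\<dots> \<le> exp (324 * d)" using two[of "324 * d"] by simp
      finally have "real (card Z) \<le> exp (324 * d)" .
      moreover have "(19 / 20 :: real) ^ n \<le> exp (- (1 / 20)) ^ n"
        using exp_ge_add_one_self[of "- (1 / 20) :: real"] by (intro power_mono) auto
      ultimately have "real (card Z) * (exp (n / 40) * (19 / 20) ^ n)
          \<le> exp (324 * d) * (exp (n / 40) * exp (- (1 / 20)) ^ n)"
        by (intro mult_mono) auto
      also have "\<dots> = exp (324 * d - n / 40)"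
        by (simp add: exp_of_nat_mult[symmetric] mult_exp_exp)
      \<comment> \<open>The count contributes 324 = 322 + 2, the 2 coming from
        \<open>3 \<le> 2 ^ 2\<close>. The factor 13000 = 40 * 325 makes the exponent at most
        \<open>- d\<close>.\<close>
      also have "\<dots> \<le> exp (- 1)" using d n by simp
      finally show ?thesis .
    qed
    show "(\<Sum>t\<in>signs d <+> Z. w t * r t ^ n) < 1"
      unfolding split using cube grid e1 by linarith
  qed
  then obtain B where B: "\<And>i. i < n \<Longrightarrow> B i \<in> signs d"
    and lt: "\<And>t. t \<in> signs d <+> Z \<Longrightarrow> w t * (\<Prod>i<n. f t (B i)) < 1" by blast
  show thesis
  proof (rule that[OF B])
    fix s assume s: "s \<in> signs d"
    have "w (Inl s) * (\<Prod>i<n. f (Inl s) (B i)) = exp ((\<Sum>i<n. \<bar>dot d (B i) s\<bar>) / sqrt d - 4 * n)"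
      by (simp add: w_def f_def exp_sum[symmetric] mult_exp_exp sum_divide_distrib)
    then have "(\<Sum>i<n. \<bar>dot d (B i) s\<bar>) / sqrt d < 4 * n"
      using lt[of "Inl s"] s by auto
    then show "(\<Sum>i<n. \<bar>dot d (B i) s\<bar>) \<le> 4 * n * sqrt d" using d by (simp add: field_simps)
  next
    fix z assume z: "z \<in> int_l1_ball d (322 * d)"
    show "n * L2_set (\<lambda>j. real_of_int (z j)) {..<d} \<le> 40 * (\<Sum>i<n. \<bar>dot d (B i) (\<lambda>j. real_of_int (z j))\<bar>)"
    proof (cases "len z > 0")
      case True
      then have "z \<in> Z" using z unfolding Z_def by simp
      have "dot d b (\<lambda>j. real_of_int (z j) / len z) = dot d b (\<lambda>j. real_of_int (z j)) / len z" for b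
        unfolding dot_def sum_divide_distrib by simp
      then have "w (Inr z) * (\<Prod>i<n. f (Inr z) (B i))
          = exp (n / 40 - (\<Sum>i<n. \<bar>dot d (B i) (\<lambda>j. real_of_int (z j))\<bar>) / len z)"
        using True by (simp add: w_def f_def exp_sum[symmetric] mult_exp_exp sum_divide_distrib sum_negf)
      then have "n / 40 < (\<Sum>i<n. \<bar>dot d (B i) (\<lambda>j. real_of_int (z j))\<bar>) / len z"
        using lt[of "Inr z"] \<open>z \<in> Z\<close> by auto
      then show ?thesis using True unfolding len_def[symmetric] by (simp add: field_simps)
    next
      case False
      then have "len z = 0" unfolding len_def by (simp add: not_less order_antisym)
      then show ?thesis unfolding len_def[symmetric] by (simp add: sum_nonneg)
    qed
  qed
qed

section \<open>From integer points to all real vectors\<close>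

lemma dot_add: "dot d b (\<lambda>j. x j + y j) = dot d b x + dot d b y"
  unfolding dot_def by (simp add: algebra_simps sum.distrib)

lemma dot_scale: "dot d b (\<lambda>j. c * y j) = c * dot d b y"
  unfolding dot_def by (simp add: sum_distrib_left mult_ac)

text \<open>A convex function on the cube is maximal at a vertex; here the vertex is explicit.\<close>

lemma sum_abs_dot_cube_le:
  fixes d n :: nat
  assumes "\<And>s. s \<in> signs d \<Longrightarrow> (\<Sum>i<n. \<bar>dot d (B i) s\<bar>) \<le> M" and v: "\<And>j. j < d \<Longrightarrow> \<bar>v j\<bar> \<le> 1"
  shows "(\<Sum>i<n. \<bar>dot d (B i) v\<bar>) \<le> M"
proof -
  \<comment> \<open>Freezing the signs of the terms at \<open>v\<close> gives a linear functional
    with coefficients \<open>c\<close>, equal to the sum at \<open>v\<close> and at most the sum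
    elsewhere; \<open>s\<close> maximizes it over the cube.\<close>
  define e where "e i = (if dot d (B i) v \<ge> 0 then 1 else - 1 :: real)" for i
  define c where "c j = (\<Sum>i<n. e i * B i j)" for j
  define s where "s = restrict (\<lambda>j. if c j \<ge> 0 then 1 else - 1 :: real) {..<d}"
  have swap: "(\<Sum>i<n. e i * dot d (B i) u) = (\<Sum>j<d. c j * u j)" for u
    unfolding dot_def c_def sum_distrib_left sum_distrib_right by (subst sum.swap) (simp only: mult_ac)
  have "(\<Sum>i<n. \<bar>dot d (B i) v\<bar>) = (\<Sum>i<n. e i * dot d (B i) v)"
    unfolding e_def by (intro sum.cong) auto
  also have "\<dots> = (\<Sum>j<d. c j * v j)" by (rule swap)
  also have "\<dots> \<le> (\<Sum>j<d. c j * s j)"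
  proof (rule sum_mono)
    fix j assume j: "j \<in> {..<d}"
    have "c j * v j \<le> \<bar>c j\<bar> * \<bar>v j\<bar>" by (metis abs_ge_self abs_mult)
    also have "\<dots> \<le> \<bar>c j\<bar> * 1" using v j by (intro mult_left_mono) auto
    also have "\<dots> = c j * s j" using j by (simp add: s_def)
    finally show "c j * v j \<le> c j * s j" .
  qed
  also have "\<dots> = (\<Sum>i<n. e i * dot d (B i) s)" by (rule swap[symmetric])
  also have "\<dots> \<le> (\<Sum>i<n. \<bar>dot d (B i) s\<bar>)"
    unfolding e_def by (intro sum_mono) auto
  also have "\<dots> \<le> M" by (rule assms(1)) (auto simp: signs_def s_def)
  finally show ?thesis .
qed

lemma sign_matrix_lower_bound:
  fixes d n :: nat
  assumes d: "d \<ge> 1"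
    and upper: "\<And>s. s \<in> signs d \<Longrightarrow> (\<Sum>i<n. \<bar>dot d (B i) s\<bar>) \<le> 4 * n * sqrt d"
    and grid: "\<And>z. z \<in> int_l1_ball d (322 * d) \<Longrightarrow>
      n * L2_set (\<lambda>j. real_of_int (z j)) {..<d} \<le> 40 * (\<Sum>i<n. \<bar>dot d (B i) (\<lambda>j. real_of_int (z j))\<bar>)"
  shows "n * L2_set y {..<d} \<le> 100 * (\<Sum>i<n. \<bar>dot d (B i) y\<bar>)"
proof (cases "L2_set y {..<d} = 0")
  case True
  then show ?thesis by (simp add: sum_nonneg)
next
  case False
  \<comment> \<open>After scaling to length \<open>321 \<surd>d\<close>, the error of rounding to an integer point lies in the unit
    cube and costs at most \<open>4 n \<surd>d\<close>, half of the \<open>8 n \<surd>d\<close> guaranteed at that integer point.\<close>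
  define c where "c = 321 * sqrt d / L2_set y {..<d}"
  have ypos: "L2_set y {..<d} > 0" using False L2_set_nonneg[of y "{..<d}"] by linarith
  then have c: "c > 0" unfolding c_def using d by simp
  define u where "u j = c * y j" for j
  have u: "L2_set u {..<d} = 321 * sqrt d"
  proof -
    have "L2_set u {..<d} = c * L2_set y {..<d}"
      unfolding u_def using c by (simp add: L2_set_right_distrib)
    then show ?thesis using ypos by (simp add: c_def)
  qed
  define z where "z = restrict (\<lambda>j. \<lfloor>u j\<rfloor>) {..<d}"
  define v where "v j = u j - real_of_int (z j)" for j
  have v: "\<bar>v j\<bar> \<le> 1" if "j < d" for j
    using that unfolding v_def z_def by simp linarith
  \<comment> \<open>Cauchy-Schwarz bounds the l1-norm by \<open>321 * d\<close>; taking floors adds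
    at most 1 per coordinate, whence the radius \<open>322 * d\<close>.\<close>
  have "(\<Sum>j<d. \<bar>u j\<bar>) \<le> 321 * real d"
  proof -
    have "(\<Sum>j<d. \<bar>1\<bar> * \<bar>u j\<bar>) \<le> L2_set (\<lambda>_. 1) {..<d} * L2_set u {..<d}" by (rule L2_set_mult_ineq)
    also have "\<dots> = 321 * real d" unfolding u by (simp add: L2_set_constant)
    finally show ?thesis by simp
  qed
  moreover have "real_of_int (\<Sum>j<d. \<bar>z j\<bar>) \<le> (\<Sum>j<d. \<bar>u j\<bar> + 1)"
    unfolding of_int_sum
  proof (rule sum_mono)
    fix j assume "j \<in> {..<d}"
    then have "\<bar>v j\<bar> \<le> 1" using v by simp
    then show "real_of_int \<bar>z j\<bar> \<le> \<bar>u j\<bar> + 1" unfolding v_def by simp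
  qed
  ultimately have "real_of_int (\<Sum>j<d. \<bar>z j\<bar>) \<le> real_of_int (int (322 * d))"
    by (simp add: sum.distrib)
  then have zsum: "(\<Sum>j<d. \<bar>z j\<bar>) \<le> int (322 * d)" by (simp only: of_int_le_iff)
  have "z \<in> int_l1_ball d (322 * d)"
  proof -
    have "\<bar>z j\<bar> \<le> int (322 * d)" if "j < d" for j
      using member_le_sum[of j "{..<d}" "\<lambda>j. \<bar>z j\<bar>"] that zsum by auto
    then have "z j \<in> {- int (322 * d)..int (322 * d)}" if "j < d" for j
      using that by (auto simp: abs_le_iff) (smt (verit) abs_le_iff that)+
    moreover have "z \<in> extensional {..<d}" unfolding z_def by simp
    ultimately show ?thesis unfolding int_l1_ball_def using zsum by (auto simp: PiE_def Pi_def)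
  qed
  from grid[OF this] have g: "n * L2_set (\<lambda>j. real_of_int (z j)) {..<d} \<le> 40 * (\<Sum>i<n. \<bar>dot d (B i) (\<lambda>j. real_of_int (z j))\<bar>)" .
  have "L2_set v {..<d} \<le> L2_set (\<lambda>_. 1) {..<d}"
  proof -
    have "L2_set v {..<d} = L2_set (\<lambda>j. \<bar>v j\<bar>) {..<d}" unfolding L2_set_def by simp
    also have "\<dots> \<le> L2_set (\<lambda>_. 1) {..<d}" using v by (intro L2_set_mono) auto
    finally show ?thesis .
  qed
  then have "L2_set v {..<d} \<le> sqrt d" by (simp add: L2_set_constant)
  moreover have "L2_set u {..<d} \<le> L2_set (\<lambda>j. real_of_int (z j)) {..<d} + L2_set v {..<d}"
    using L2_set_triangle_ineq[of "\<lambda>j. real_of_int (z j)" v "{..<d}"] by (simp add: v_def)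
  \<comment> \<open>Rounding costs at most \<open>sqrt d\<close> of the length 321
    \<open>sqrt d\<close>; the remaining 320, divided by the 40 of \<open>grid\<close>, gives the 8
    below.\<close>
  ultimately have zl: "320 * sqrt d \<le> L2_set (\<lambda>j. real_of_int (z j)) {..<d}" using u by simp
  have "n * (320 * sqrt d) \<le> n * L2_set (\<lambda>j. real_of_int (z j)) {..<d}" using zl by (intro mult_left_mono) auto
  with g have "8 * (n * sqrt d) \<le> (\<Sum>i<n. \<bar>dot d (B i) (\<lambda>j. real_of_int (z j))\<bar>)" by simp
  also have "\<dots> \<le> (\<Sum>i<n. \<bar>dot d (B i) u\<bar> + \<bar>dot d (B i) v\<bar>)"
  proof (rule sum_mono)
    fix i
    have "dot d (B i) u = dot d (B i) (\<lambda>j. real_of_int (z j)) + dot d (B i) v"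
      unfolding dot_add[symmetric] by (simp add: v_def)
    then show "\<bar>dot d (B i) (\<lambda>j. real_of_int (z j))\<bar> \<le> \<bar>dot d (B i) u\<bar> + \<bar>dot d (B i) v\<bar>" by linarith
  qed
  also have "\<dots> \<le> (\<Sum>i<n. \<bar>dot d (B i) u\<bar>) + 4 * n * sqrt d"
    unfolding sum.distrib using sum_abs_dot_cube_le[OF upper v] by simp
  finally have "4 * (n * sqrt d) \<le> (\<Sum>i<n. \<bar>dot d (B i) u\<bar>)" by simp
  also have "\<dots> = c * (\<Sum>i<n. \<bar>dot d (B i) y\<bar>)"
    unfolding u_def dot_scale abs_mult sum_distrib_left using c by simp
  finally have "4 * (n * sqrt d) * L2_set y {..<d} \<le> 321 * sqrt d * (\<Sum>i<n. \<bar>dot d (B i) y\<bar>)"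
    using ypos unfolding c_def by (simp add: field_simps)
  then have "sqrt d * (4 * (n * L2_set y {..<d})) \<le> sqrt d * (321 * (\<Sum>i<n. \<bar>dot d (B i) y\<bar>))"
    by (simp add: mult_ac)
  then have "4 * (n * L2_set y {..<d}) \<le> 321 * (\<Sum>i<n. \<bar>dot d (B i) y\<bar>)"
    using d by (subst (asm) mult_le_cancel_left_pos) auto
  moreover have "0 \<le> (\<Sum>i<n. \<bar>dot d (B i) y\<bar>)" by (simp add: sum_nonneg)
  \<comment> \<open>The constant 321/4 is rounded up to 100.\<close>
  ultimately show ?thesis by linarith
qed

section \<open>Left inverse of an injective matrix\<close>

text \<open>The rows \<open>l j\<close> form a left inverse of the matrix with columns \<open>c k\<close>.\<close>

lemma dual_family_exists:
  fixes c :: "nat \<Rightarrow> nat \<Rightarrow> real" and d n :: nat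
  assumes "\<And>y. (\<And>i. i < n \<Longrightarrow> (\<Sum>j<d. c j i * y j) = 0) \<Longrightarrow> (\<And>j. j < d \<Longrightarrow> y j = 0)"
  obtains l where "\<And>j k. j < d \<Longrightarrow> k < d \<Longrightarrow> (\<Sum>i<n. l j i * c k i) = (if j = k then 1 else 0)"
proof -
  have "\<exists>l. \<forall>j<d. \<forall>k<d. (\<Sum>i<n. l j i * c k i) = (if j = k then 1 else 0)"
    using assms
  proof (induction d)
    case (Suc d)
    have "\<exists>l. \<forall>j<d. \<forall>k<d. (\<Sum>i<n. l j i * c k i) = (if j = k then 1 else 0)"
    proof (rule Suc.IH)
      fix y j assume y: "\<And>i. i < n \<Longrightarrow> (\<Sum>j<d. c j i * y j) = 0" and j: "j < d"
      have "(\<Sum>j<Suc d. c j i * (y(d := 0)) j) = 0" if "i < n" for i using y[OF that] by simp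
      from Suc.prems[of "y(d := 0)", OF this, of j] j show "y j = 0" by simp
    qed
    then obtain l where l: "\<And>j k. j < d \<Longrightarrow> k < d \<Longrightarrow> (\<Sum>i<n. l j i * c k i) = (if j = k then 1 else 0)" by blast
    define a where "a j = (\<Sum>i<n. l j i * c d i)" for j
    define r where "r i = c d i - (\<Sum>j<d. a j * c j i)" for i
    \<comment> \<open>\<open>r\<close> is column \<open>d\<close> minus its projection, defined by
      \<open>l\<close>, onto the span of the earlier columns; \<open>r = 0\<close> would be a linear
      dependence.\<close>
    have "\<exists>i<n. r i \<noteq> 0"
    proof (rule ccontr)
      assume "\<not> (\<exists>i<n. r i \<noteq> 0)"
      then have "(\<Sum>j<Suc d. c j i * ((\<lambda>j. - a j)(d := 1)) j) = 0" if "i < n" for i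
        using that unfolding r_def by (simp add: sum_negf mult.commute)
      from Suc.prems[of "(\<lambda>j. - a j)(d := 1)", OF this, of d] show False by simp
    qed
    then obtain m where m: "m < n" "r m \<noteq> 0" by blast
    \<comment> \<open>Entry \<open>m\<close> of a vector after removing that projection, scaled by
      \<open>r m\<close>: zero on the earlier columns, one on column \<open>d\<close>.\<close>
    define q where "q i = ((if i = m then 1 else 0) - (\<Sum>j<d. l j i * c j m)) / r m" for i
    have q: "(\<Sum>i<n. q i * x i) = (x m - (\<Sum>j<d. (\<Sum>i<n. l j i * x i) * c j m)) / r m" for x
    proof -
      have "(\<Sum>i<n. q i * x i) = (\<Sum>i<n. (if i = m then x i else 0) - (\<Sum>j<d. l j i * x i * c j m)) / r m"
        unfolding sum_divide_distrib
      proof (intro sum.cong refl)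
        fix i
        have "(\<Sum>j<d. l j i * c j m) * x i = (\<Sum>j<d. l j i * x i * c j m)"
          unfolding sum_distrib_right by (simp only: mult_ac)
        then show "q i * x i = ((if i = m then x i else 0) - (\<Sum>j<d. l j i * x i * c j m)) / r m"
          unfolding q_def by (simp add: left_diff_distrib)
      qed
      also have "\<dots> = (x m - (\<Sum>i<n. \<Sum>j<d. l j i * x i * c j m)) / r m"
        using m(1) by (simp add: sum_subtractf)
      also have "(\<Sum>i<n. \<Sum>j<d. l j i * x i * c j m) = (\<Sum>j<d. (\<Sum>i<n. l j i * x i) * c j m)"
        unfolding sum_distrib_right by (rule sum.swap)
      finally show ?thesis .
    qed
    have q1: "(\<Sum>i<n. q i * c k i) = 0" if "k < d" for k
    proof -
      have "(\<Sum>j<d. (\<Sum>i<n. l j i * c k i) * c j m) = (\<Sum>j<d. if j = k then c k m else 0)"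
        using l that by (intro sum.cong) auto
      then show ?thesis unfolding q using that by simp
    qed
    have q2: "(\<Sum>i<n. q i * c d i) = 1"
      unfolding q a_def[symmetric] using m(2) by (simp add: r_def)
    \<comment> \<open>Subtracting \<open>a j * q\<close> makes the old functionals vanish on the new
      column without changing them on the earlier ones.\<close>
    define l' where "l' j i = (if j = d then q i else l j i - a j * q i)" for j i
    have l': "(\<Sum>i<n. l' j i * c k i) = (\<Sum>i<n. l j i * c k i) - a j * (\<Sum>i<n. q i * c k i)" if "j < d" for j k
      using that unfolding l'_def
      by (simp add: left_diff_distrib sum_subtractf sum_distrib_left mult.assoc)
    have "(\<Sum>i<n. l' j i * c k i) = (if j = k then 1 else 0)" if jk: "j < Suc d" "k < Suc d" for j k
    proof (cases "j = d")
      case True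
      then have "(\<Sum>i<n. l' j i * c k i) = (\<Sum>i<n. q i * c k i)" unfolding l'_def by simp
      then show ?thesis using q1[of k] q2 True jk by (cases "k = d") auto
    next
      case False
      then have "j < d" using jk by simp
      then show ?thesis using q1[of k] q2 l[of j k] jk False
        by (cases "k = d") (auto simp: l' a_def)
    qed
    then show ?case by blast
  qed simp
  then show thesis using that by blast
qed

section \<open>The lower bound\<close>

text \<open>\<open>B\<close> is real, so \<open>lower\<close> applies separately to the real and
  imaginary parts of \<open>y\<close>, whose images are dominated entrywise by \<open>x\<close>.
  Each part contributes 100 squared.\<close>

lemma range_l1_bound:
  fixes d n :: nat
  assumes lower: "\<And>y. n * L2_set y {..<d} \<le> 100 * (\<Sum>i<n. \<bar>dot d (B i) y\<bar>)"
    and x: "\<And>i. i < n \<Longrightarrow> x i = (\<Sum>j<d. complex_of_real (B i j) * y j)"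
  shows "(real n)\<^sup>2 * (\<Sum>j<d. (cmod (y j))\<^sup>2) \<le> 20000 * (vec_l1 n x)\<^sup>2"
proof -
  have part: "(real n)\<^sup>2 * (\<Sum>j<d. (u j)\<^sup>2) \<le> 10000 * (vec_l1 n x)\<^sup>2"
    if u: "\<And>i. i < n \<Longrightarrow> \<bar>dot d (B i) u\<bar> \<le> cmod (x i)" for u
  proof -
    have "n * L2_set u {..<d} \<le> 100 * (\<Sum>i<n. \<bar>dot d (B i) u\<bar>)" by (rule lower)
    also have "\<dots> \<le> 100 * vec_l1 n x"
      unfolding vec_l1_def using u by (intro mult_left_mono sum_mono) auto
    finally have "(n * L2_set u {..<d})\<^sup>2 \<le> (100 * vec_l1 n x)\<^sup>2"
      by (intro power_mono) auto
    then show ?thesis by (simp add: power_mult_distrib L2_set_def sum_nonneg)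
  qed
  have "\<bar>dot d (B i) (\<lambda>j. Re (y j))\<bar> \<le> cmod (x i)" if "i < n" for i
    using abs_Re_le_cmod[of "x i"] x[OF that] by (simp add: dot_def)
  from part[OF this] have "(real n)\<^sup>2 * (\<Sum>j<d. (Re (y j))\<^sup>2) \<le> 10000 * (vec_l1 n x)\<^sup>2" .
  moreover have "\<bar>dot d (B i) (\<lambda>j. Im (y j))\<bar> \<le> cmod (x i)" if "i < n" for i
    using abs_Im_le_cmod[of "x i"] x[OF that] by (simp add: dot_def)
  from part[OF this] have "(real n)\<^sup>2 * (\<Sum>j<d. (Im (y j))\<^sup>2) \<le> 10000 * (vec_l1 n x)\<^sup>2" .
  ultimately show ?thesis
    by (simp add: cmod_power2 sum.distrib distrib_left)
qed

lemma gram_decomp_l1_bound: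
  fixes d n :: nat
  assumes lower: "\<And>y. n * L2_set y {..<d} \<le> 100 * (\<Sum>i<n. \<bar>dot d (B i) y\<bar>)" and n: "n \<ge> 1"
    and xs: "is_decomp n (\<lambda>i j. complex_of_real (dot d (B i) (B j))) p xs"
  shows "(real n)\<^sup>2 * d / 20000 \<le> (\<Sum>k<p. (vec_l1 n (xs k))\<^sup>2)"
proof -
  \<comment> \<open>Both \<open>xs\<close> and the columns of \<open>B\<close> decompose \<open>B B\<^sup>T\<close>, so linear functionals have the same sum of
    squares on the two families. Functionals vanishing on the range of \<open>B\<close> vanish on every \<open>xs k\<close>,
    and a left inverse of \<open>B\<close> turns \<open>xs\<close> into a decomposition of the identity.\<close>
  have cols: "is_decomp n (\<lambda>i j. complex_of_real (dot d (B i) (B j))) d (\<lambda>t i. complex_of_real (B i t))"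
    unfolding is_decomp_def dot_def by simp
  have form: "(\<Sum>k<p. (cmod (\<Sum>i<n. complex_of_real (L i) * xs k i))\<^sup>2) = (\<Sum>t<d. (\<Sum>i<n. L i * B i t)\<^sup>2)" for L
  proof -
    have "(\<Sum>k<p. (cmod (\<Sum>i<n. complex_of_real (L i) * xs k i))\<^sup>2)
        = (\<Sum>t<d. (cmod (\<Sum>i<n. complex_of_real (L i) * complex_of_real (B i t)))\<^sup>2)"
      using decomp_form[OF xs, of "\<lambda>i. complex_of_real (L i)", folded decomp_form[OF cols]]
      by (simp only: of_real_eq_iff)
    also have "\<dots> = (\<Sum>t<d. (\<Sum>i<n. L i * B i t)\<^sup>2)"
      by (simp only: of_real_mult[symmetric] of_real_sum[symmetric] norm_of_real power2_abs)
    finally show ?thesis .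
  qed
  obtain l where l: "\<And>j k. j < d \<Longrightarrow> k < d \<Longrightarrow> (\<Sum>i<n. l j i * B i k) = (if j = k then 1 else 0)"
  proof (rule dual_family_exists[of n "\<lambda>k i. B i k" d])
    fix y j assume y: "\<And>i. i < n \<Longrightarrow> (\<Sum>j<d. B i j * y j) = 0" and j: "j < d"
    have "n * L2_set y {..<d} \<le> 0" using lower[of y] y by (simp add: dot_def)
    then have "L2_set y {..<d} = 0" using n L2_set_nonneg[of y "{..<d}"] by (simp add: mult_le_0_iff)
    then show "y j = 0" using j by (simp add: L2_set_eq_0_iff)
  qed (use that in blast)
  define y where "y k j = (\<Sum>i<n. complex_of_real (l j i) * xs k i)" for k j
  \<comment> \<open>The diagonal of the decomposition of the identity; its trace supplies the factor
    \<open>d\<close>.\<close>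
  have y1: "(\<Sum>k<p. (cmod (y k j))\<^sup>2) = 1" if "j < d" for j
  proof -
    have "(\<Sum>k<p. (cmod (y k j))\<^sup>2) = (\<Sum>t<d. if t = j then 1 else 0)"
      unfolding y_def form by (intro sum.cong refl) (use l that in auto)
    then show ?thesis using that by simp
  qed
  have x: "xs k m = (\<Sum>j<d. complex_of_real (B m j) * y k j)" if k: "k < p" and m: "m < n" for k m
  proof -
    \<comment> \<open>Row \<open>m\<close> of the identity minus \<open>B\<close> times its left
      inverse, a functional vanishing on the columns of \<open>B\<close>.\<close>
    define L where "L i = (if i = m then 1 else 0) - (\<Sum>j<d. B m j * l j i)" for i
    have "(\<Sum>i<n. L i * B i t) = 0" if t: "t < d" for t
    proof -
      have "(\<Sum>i<n. L i * B i t) = (\<Sum>i<n. (if i = m then B i t else 0) - (\<Sum>j<d. B m j * (l j i * B i t)))"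
        unfolding L_def by (intro sum.cong refl) (simp add: left_diff_distrib sum_distrib_right mult.assoc)
      also have "\<dots> = B m t - (\<Sum>j<d. B m j * (\<Sum>i<n. l j i * B i t))"
        unfolding sum_subtractf sum_distrib_left using m by (subst (2) sum.swap) simp
      also have "(\<Sum>j<d. B m j * (\<Sum>i<n. l j i * B i t)) = (\<Sum>j<d. if j = t then B m j else 0)"
        using l t by (intro sum.cong) auto
      also have "B m t - \<dots> = 0" using t by simp
      finally show ?thesis .
    qed
    then have "(\<Sum>k<p. (cmod (\<Sum>i<n. complex_of_real (L i) * xs k i))\<^sup>2) = 0"
      unfolding form by simp
    then have "(\<Sum>i<n. complex_of_real (L i) * xs k i) = 0"
      using k by (subst (asm) sum_nonneg_eq_0_iff) auto
    moreover have "(\<Sum>i<n. complex_of_real (L i) * xs k i)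
        = (\<Sum>i<n. (if i = m then xs k i else 0) - (\<Sum>j<d. complex_of_real (B m j) * (complex_of_real (l j i) * xs k i)))"
      unfolding L_def by (intro sum.cong refl) (simp add: left_diff_distrib sum_distrib_right mult.assoc)
    moreover have "\<dots> = xs k m - (\<Sum>j<d. complex_of_real (B m j) * y k j)"
      unfolding sum_subtractf sum_distrib_left y_def using m by (subst (2) sum.swap) simp
    ultimately show ?thesis by simp
  qed
  have "(real n)\<^sup>2 * d = (real n)\<^sup>2 * (\<Sum>j<d. \<Sum>k<p. (cmod (y k j))\<^sup>2)" using y1 by simp
  also have "\<dots> = (\<Sum>k<p. (real n)\<^sup>2 * (\<Sum>j<d. (cmod (y k j))\<^sup>2))"
    unfolding sum_distrib_left by (rule sum.swap)
  also have "\<dots> \<le> (\<Sum>k<p. 20000 * (vec_l1 n (xs k))\<^sup>2)"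
    using x by (intro sum_mono range_l1_bound[where B = B and x = "xs _", OF lower]) auto
  also have "\<dots> = 20000 * (\<Sum>k<p. (vec_l1 n (xs k))\<^sup>2)" by (simp add: sum_distrib_left)
  finally show ?thesis by simp
qed

text \<open>The quotient of the lower bound \<open>n\<^sup>2 * d / 20000\<close> for
  \<open>gamma_plus\<close> by the upper bound \<open>4 * n\<^sup>2 * sqrt d\<close> for the
  entrywise norm.\<close>

lemma C_const_ge_sqrt_dim:
  fixes d n :: nat
  assumes d: "d \<ge> 1" and n: "n \<ge> 13000 * d"
  shows "sqrt d / 80000 \<le> C_const n"
proof -
  obtain B where B: "\<And>i. i < n \<Longrightarrow> B i \<in> signs d"
    and upper: "\<And>s. s \<in> signs d \<Longrightarrow> (\<Sum>i<n. \<bar>dot d (B i) s\<bar>) \<le> 4 * n * sqrt d"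
    and grid: "\<And>z. z \<in> int_l1_ball d (322 * d) \<Longrightarrow>
      n * L2_set (\<lambda>j. real_of_int (z j)) {..<d} \<le> 40 * (\<Sum>i<n. \<bar>dot d (B i) (\<lambda>j. real_of_int (z j))\<bar>)"
    using exists_sign_matrix[OF d n] by blast
  define A where "A i j = complex_of_real (dot d (B i) (B j))" for i j
  have "is_decomp n A d (\<lambda>t i. complex_of_real (B i t))"
    unfolding is_decomp_def dot_def A_def by simp
  then have psd: "psd n A" by (rule psd_if_decomp)
  have n1: "n \<ge> 1" using d n by simp
  have lower: "n * L2_set y {..<d} \<le> 100 * (\<Sum>i<n. \<bar>dot d (B i) y\<bar>)" for y
    by (rule sign_matrix_lower_bound[OF d upper grid])
  have gamma: "(real n)\<^sup>2 * d / 20000 \<le> gamma_plus n A"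
    using gram_decomp_l1_bound[OF lower n1, folded A_def] by (intro gamma_plus_ge[OF psd])
  have "B 0 j * B 0 j = 1" if "j < d" for j
    using B[of 0] n1 that unfolding signs_def by (auto simp: PiE_def Pi_def)
  then have "A 0 0 = of_nat d" unfolding A_def dot_def by simp
  then have nz: "nonzero_mat n A" unfolding nonzero_mat_def using n1 d by (intro exI[of _ 0] conjI) auto
  have "mat_l1 n A = (\<Sum>j<n. \<Sum>i<n. \<bar>dot d (B i) (B j)\<bar>)"
    unfolding mat_l1_def A_def by (subst sum.swap) simp
  also have "\<dots> \<le> (\<Sum>j<n. 4 * n * sqrt d)"
    using upper B by (intro sum_mono) auto
  finally have "mat_l1 n A \<le> n * (4 * n * sqrt d)" by simp
  then have "sqrt d / 80000 * mat_l1 n A \<le> sqrt d / 80000 * (n * (4 * n * sqrt d))"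
    by (intro mult_left_mono) auto
  also have "\<dots> = (real n)\<^sup>2 * d / 20000" by (simp add: power2_eq_square)
  also note gamma
  finally show ?thesis by (rule C_const_ge[OF psd nz])
qed

theorem theorem1:
  shows "\<exists>c::real. c > 0 \<and>
           (\<forall>n::nat. n \<ge> 1 \<longrightarrow> c * sqrt (real n) \<le> C_const n \<and> C_const n \<le> real n)"
proof (intro exI[of _ "1 / (80000 * sqrt 26000)"] conjI allI impI)
  fix n :: nat assume n: "n \<ge> 1"
  show "C_const n \<le> real n" by (rule C_const_le[OF n])
  show "1 / (80000 * sqrt 26000) * sqrt (real n) \<le> C_const n"
  proof (cases "n \<ge> 13000")
    case True
    \<comment> \<open>Since \<open>d \<ge> 1\<close>,
      \<open>n < 13000 * (d + 1) \<le> 26000 * d\<close>, which is the source of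
      \<open>sqrt 26000\<close>.\<close>
    define d where "d = n div 13000"
    have "13000 * d + n mod 13000 = n" "n mod 13000 < 13000" unfolding d_def by simp_all
    moreover have d: "d \<ge> 1" using True unfolding d_def by (simp add: less_eq_div_iff_mult_less_eq)
    ultimately have nd: "13000 * d \<le> n" "n \<le> 26000 * d" by linarith+
    have "sqrt (real n) \<le> sqrt (26000 * real d)" using nd(2) by simp
    then have "1 / (80000 * sqrt 26000) * sqrt (real n) \<le> sqrt d / 80000"
      by (simp add: real_sqrt_mult field_simps)
    also have "\<dots> \<le> C_const n" by (rule C_const_ge_sqrt_dim[OF d nd(1)])
    finally show ?thesis .
  next
    case False
    \<comment> \<open>Too few rows for the sign matrix even with \<open>d = 1\<close>; here the
      claimed bound is below the trivial bound 1.\<close>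
    then have "sqrt (real n) \<le> sqrt 26000" by simp
    also have "\<dots> \<le> 80000 * sqrt 26000" by simp
    finally have "1 / (80000 * sqrt 26000) * sqrt (real n) \<le> 1" by (simp add: field_simps)
    also have "\<dots> \<le> C_const n" by (rule C_const_ge_1[OF n])
    finally show ?thesis .
  qed
qed simp

end
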